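(* Let $K\ge1$ and consider on $(\mathbb C^\times)^{2K}$, with coordinates $y_1,\dots,y_{2K}$, the symplectic form $$\mathcal W_K=4\sum_{k=1}^{K}\sum_{j=k}^{K}d\log y_{2k-1}\wedge d\log y_{2j}.$$ Let $\mathbf\Omega_K$ be its skew-symmetric coefficient matrix with respect to the variables $\log y_1,\dots,\log y_{2K}$, i.e. $\mathcal W_K=\sum_{i<j}(\mathbf\Omega_K)_{ij}\,d\log y_i\wedge d\log y_j$, and let $\mathbf P_K:=(\mathbf\Omega_K^{-1})^{T}$, so that the induced Poisson structure is $\{y_i,y_j\}=(\mathbf P_K)_{ij}\,y_iy_j$. Then $\mathbf P_K$ is the $2K\times2K$ tridiagonal matrix $$\mathbf P_K=\frac14\begin{pmatrix}0&1&0&\cdots&0\\-1&0&1&\cdots&0\\0&-1&0&\ddots&\vdots\\\vdots&&\ddots&\ddots&1\\0&\cdots&0&-1&0\end{pmatrix},$$ i.e. $(\mathbf P_K)_{i,i+1}=\frac14$, $(\mathbf P_K)_{i+1,i}=-\frac14$, and all other entries vanish.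
   Context: The form $\mathcal W_K$ is the Stokes two-form of rank-two polynomial connections of degree $K$ expressed in the parameters $y_j$. *)

theory Defs
  imports "HOL-Analysis.Derivative" "Jordan_Normal_Form.Gauss_Jordan_Elimination"
begin

text \<open>
  Points and tangent vectors of $({\mathbb C}^\times)^n$ are elements of \<open>carrier_vec n\<close>.
  Coordinates are numbered \<open>1, \<dots>, n\<close>, whereas vector and matrix entries are indexed from \<open>0\<close>.
  A differential form is a function of the base point, followed by its tangent vector arguments.
\<close>

type_synonym one_form = "complex vec \<Rightarrow> complex vec \<Rightarrow> complex"
type_synonym two_form = "complex vec \<Rightarrow> complex vec \<Rightarrow> complex vec \<Rightarrow> complex"

definition torus :: "nat \<Rightarrow> complex vec set" where
  "torus n = {y \<in> carrier_vec n. \<forall>i<n. y $ i \<noteq> 0}"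

definition coord :: "nat \<Rightarrow> complex vec \<Rightarrow> complex" where
  "coord i y = y $ (i - 1)"

text \<open>The differential of a holomorphic function: \<open>dif f y v\<close> is the derivative of \<open>f\<close> at \<open>y\<close>
  in the direction \<open>v\<close>.\<close>

definition dif :: "(complex vec \<Rightarrow> complex) \<Rightarrow> one_form" where
  "dif f y v = deriv (\<lambda>t. f (y + t \<cdot>\<^sub>v v)) 0"

text \<open>\<open>d log f = df / f\<close>; this does not depend on a branch of the logarithm.\<close>

definition dlog :: "(complex vec \<Rightarrow> complex) \<Rightarrow> one_form" where
  "dlog f y v = dif f y v / f y"

definition wedge :: "one_form \<Rightarrow> one_form \<Rightarrow> two_form" where
  "wedge \<alpha> \<beta> y u v = \<alpha> y u * \<beta> y v - \<alpha> y v * \<beta> y u"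

text \<open>Exterior derivative, evaluated on constant vector fields, so that the terms with Lie brackets
  in the invariant formula vanish.\<close>

definition closed_form :: "nat \<Rightarrow> two_form \<Rightarrow> bool" where
  "closed_form n \<omega> \<longleftrightarrow>
     (\<forall>y\<in>torus n. \<forall>u\<in>carrier_vec n. \<forall>v\<in>carrier_vec n. \<forall>w\<in>carrier_vec n.
        dif (\<lambda>z. \<omega> z v w) y u - dif (\<lambda>z. \<omega> z u w) y v + dif (\<lambda>z. \<omega> z u v) y w = 0)"

definition nondegenerate_form :: "nat \<Rightarrow> two_form \<Rightarrow> bool" where
  "nondegenerate_form n \<omega> \<longleftrightarrow>
     (\<forall>y\<in>torus n. \<forall>u\<in>carrier_vec n. (\<forall>v\<in>carrier_vec n. \<omega> y u v = 0) \<longrightarrow> u = 0\<^sub>v n)"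

definition W :: "nat \<Rightarrow> two_form" where
  "W K y u v =
     4 * (\<Sum>k=1..K. \<Sum>j=k..K. wedge (dlog (coord (2*k-1))) (dlog (coord (2*j))) y u v)"

definition is_log_coeff_mat :: "nat \<Rightarrow> two_form \<Rightarrow> complex mat \<Rightarrow> bool" where
  "is_log_coeff_mat n \<omega> M \<longleftrightarrow>
     M \<in> carrier_mat n n \<and> transpose_mat M = - M \<and>
     (\<forall>y\<in>torus n. \<forall>u\<in>carrier_vec n. \<forall>v\<in>carrier_vec n.
        \<omega> y u v = (\<Sum>j=1..n. \<Sum>i=1..<j.
          M $$ (i-1, j-1) * wedge (dlog (coord i)) (dlog (coord j)) y u v))"

definition Omega :: "nat \<Rightarrow> complex mat" where
  "Omega K = (THE M. is_log_coeff_mat (2*K) (W K) M)"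

text \<open>\<open>mat_inverse\<close> returns \<open>None\<close> on singular matrices, hence \<open>P K\<close> is only meaningful once
  \<open>Omega K\<close> is known to be invertible.\<close>

definition P :: "nat \<Rightarrow> complex mat" where
  "P K = transpose_mat (the (mat_inverse (Omega K)))"

text \<open>The Poisson bracket \<open>{f, g} = \<omega>(X\<^sub>f, X\<^sub>g)\<close>, where \<open>\<omega>(X\<^sub>f, \<cdot>) = df\<close>; the opposite sign in the
  definition of \<open>X\<^sub>f\<close> leads to the same bracket.\<close>

definition hamiltonian_vector ::
    "nat \<Rightarrow> two_form \<Rightarrow> (complex vec \<Rightarrow> complex) \<Rightarrow> complex vec \<Rightarrow> complex vec" where
  "hamiltonian_vector n \<omega> f y =
     (THE X. X \<in> carrier_vec n \<and> (\<forall>v\<in>carrier_vec n. \<omega> y X v = dif f y v))"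

definition poisson_bracket ::
    "nat \<Rightarrow> two_form \<Rightarrow> (complex vec \<Rightarrow> complex) \<Rightarrow> (complex vec \<Rightarrow> complex) \<Rightarrow> complex vec \<Rightarrow> complex" where
  "poisson_bracket n \<omega> f g y =
     \<omega> y (hamiltonian_vector n \<omega> f y) (hamiltonian_vector n \<omega> g y)"

end

theory Submission
  imports Defs "Jordan_Normal_Form.Determinant"
begin

text \<open>
  In the frame \<open>y\<^sub>i \<partial>/\<partial>y\<^sub>i\<close>, dual to \<open>d log y\<^sub>i\<close>, a two-form with constant logarithmic
  coefficients becomes the constant bilinear form \<open>(x, x') \<mapsto> x \<bullet> M x'\<close> of its skew coefficient
  matrix \<open>M\<close>. Evaluating on the frame shows that \<open>M\<close> is unique; if \<open>M\<close> is invertible, then the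
  Hamiltonian vector field of \<open>y\<^sub>j\<close> is \<open>y\<^sub>j\<close> times row \<open>j\<close> of the inverse of \<open>M\<close>, and
  \<open>{y\<^sub>i, y\<^sub>j} = dy\<^sub>i(X\<^sub>j)\<close> gives the brackets. For the form \<open>W K\<close> the product of \<open>M\<close> with the
  claimed inverse telescopes to the identity.
\<close>

unbundle no vec_syntax

section \<open>Reindexing of double sums\<close>

lemma sum_all_pairs_eq:
  fixes G :: "nat \<Rightarrow> nat \<Rightarrow> 'a::comm_monoid_add"
  assumes "\<And>i. G i i = 0"
  shows "(\<Sum>i<n. \<Sum>j<n. G i j) = (\<Sum>j<n. \<Sum>i<j. G i j + G j i)"
  by (induction n) (simp_all add: assms sum.distrib ac_simps)

text \<open>As \<open>k \<le> j\<close> iff \<open>2*k-1 < 2*j\<close>, the sum defining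
  \<open>W\<close> runs over the increasing pairs with odd first and even second index. After
  exchanging the order over the triangle, parity indicators give it the shape required by
  \<open>is_log_coeff_mat\<close>.\<close>

lemma sum_odd_even_pairs:
  fixes g :: "nat \<Rightarrow> nat \<Rightarrow> 'a::comm_monoid_add"
  shows "(\<Sum>k=1..K. \<Sum>j=k..K. g (2*k-1) (2*j))
       = (\<Sum>j=1..2*K. \<Sum>i=1..<j. if odd i \<and> even j then g i j else 0)"
proof -
  have inner: "(\<Sum>i=1..<2*j. if odd i then f i else 0) = (\<Sum>k=1..j. f (2*k-1))"
    for j and f :: "nat \<Rightarrow> 'a"
    by (induction j) (auto simp: sum.atLeastLessThan_Suc)
  have outer: "(\<Sum>j=1..2*K. if even j then h j else 0) = (\<Sum>j=1..K. h (2*j))"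
    for h :: "nat \<Rightarrow> 'a"
    by (induction K) auto
  have "(\<Sum>k=1..K. \<Sum>j=k..K. g (2*k-1) (2*j)) = (\<Sum>j=1..K. \<Sum>k=1..j. g (2*k-1) (2*j))"
    by (induction K) (simp_all add: sum.distrib)
  also have "\<dots> = (\<Sum>j=1..K. \<Sum>i=1..<2*j. if odd i then g i (2*j) else 0)"
    by (simp only: inner)
  also have "\<dots> = (\<Sum>j=1..2*K. if even j then \<Sum>i=1..<j. if odd i then g i j else 0 else 0)"
    by (simp only: outer)
  also have "\<dots> = (\<Sum>j=1..2*K. \<Sum>i=1..<j. if odd i \<and> even j then g i j else 0)"
    by (intro sum.cong) auto
  finally show ?thesis .
qed

section \<open>Differentials of coordinates and closedness\<close>

lemma torus_carrier: "y \<in> torus n \<Longrightarrow> y \<in> carrier_vec n"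
  by (simp add: torus_def)

lemma dif_eqI:
  "((\<lambda>t. f (y + t \<cdot>\<^sub>v v)) has_field_derivative D) (at 0) \<Longrightarrow> dif f y v = D"
  unfolding dif_def by (rule DERIV_imp_deriv)

lemma dif_coord:
  assumes "v \<in> carrier_vec n" "y \<in> carrier_vec n" "i \<in> {1..n}"
  shows "dif (coord i) y v = v $ (i - 1)"
proof (rule dif_eqI)
  have "(\<lambda>t. coord i (y + t \<cdot>\<^sub>v v)) = (\<lambda>t. y $ (i-1) + t * v $ (i-1))"
    using assms by (auto simp: coord_def)
  thus "((\<lambda>t. coord i (y + t \<cdot>\<^sub>v v)) has_field_derivative v $ (i-1)) (at 0)"
    by (auto intro!: derivative_eq_intros)
qed

lemma dlog_coord:
  assumes "v \<in> carrier_vec n" "y \<in> carrier_vec n" "i \<in> {1..n}"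
  shows "dlog (coord i) y v = v $ (i - 1) / y $ (i - 1)"
  using dif_coord[OF assms] by (simp add: dlog_def coord_def)

text \<open>On a constant vector field \<open>v\<close> the form \<open>d log y_i\<close> takes the
  nonconstant value \<open>v_i / y_i\<close>; its derivative along \<open>u\<close> is
  \<open>- u_i * v_i / y_i^2\<close>.\<close>

lemma has_derivative_dlog_coord:
  assumes "u \<in> carrier_vec n" "v \<in> carrier_vec n" "y \<in> torus n" "i \<in> {1..n}"
  shows "((\<lambda>t. dlog (coord i) (y + t \<cdot>\<^sub>v u) v) has_field_derivative
            - dlog (coord i) y u * dlog (coord i) y v) (at 0)"
proof -
  have y: "y \<in> carrier_vec n" "y $ (i - 1) \<noteq> 0"
    using assms by (auto simp: torus_def)
  have "(\<lambda>t. dlog (coord i) (y + t \<cdot>\<^sub>v u) v)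
      = (\<lambda>t. v $ (i-1) / (y $ (i-1) + t * u $ (i-1)))"
    using assms y by (subst dlog_coord[of _ n]) auto
  moreover have "((\<lambda>t. v $ (i-1) / (y $ (i-1) + t * u $ (i-1))) has_field_derivative
      - (u $ (i-1) / y $ (i-1)) * (v $ (i-1) / y $ (i-1))) (at 0)"
    using y by (auto intro!: derivative_eq_intros simp: field_simps)
  ultimately show ?thesis
    using assms y by (simp add: dlog_coord[of _ n])
qed

text \<open>By the product rule each summand has the derivative \<open>D\<close>. Alternating
  \<open>D\<close> over the three vectors gives, up to sign,
  \<open>(l_a + l_b) \<and> l_a \<and> l_b\<close> for the one-forms \<open>l_i = d log y_i\<close>,
  which vanishes because a factor repeats.\<close>

lemma closed_form_W: "closed_form (2*K) (W K)"
  unfolding closed_form_def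
proof (intro ballI)
  fix y u v w :: "complex vec"
  assume y: "y \<in> torus (2*K)"
    and uvw: "u \<in> carrier_vec (2*K)" "v \<in> carrier_vec (2*K)" "w \<in> carrier_vec (2*K)"
  let ?l = "\<lambda>i. dlog (coord i) y"
  define D where "D a b p q r =
      - (?l a p + ?l b p) * wedge (dlog (coord a)) (dlog (coord b)) y q r" for a b p q r
  have dif: "dif (\<lambda>z. W K z q r) y p = 4 * (\<Sum>k=1..K. \<Sum>j=k..K. D (2*k-1) (2*j) p q r)"
    if "p \<in> carrier_vec (2*K)" "q \<in> carrier_vec (2*K)" "r \<in> carrier_vec (2*K)" for p q r
    unfolding W_def wedge_def
  proof (rule dif_eqI, intro DERIV_cmult DERIV_sum)
    fix k j assume kj: "k \<in> {1..K}" "j \<in> {k..K}"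
    have "2*k-1 \<in> {1..2*K}" "2*j \<in> {1..2*K}" using kj by auto
    note d = has_derivative_dlog_coord[OF that(1) _ y this(1)]
      has_derivative_dlog_coord[OF that(1) _ y this(2)]
    note deriv = DERIV_diff[OF DERIV_mult[OF d(1)[OF that(2)] d(2)[OF that(3)]]
        DERIV_mult[OF d(1)[OF that(3)] d(2)[OF that(2)]]]
    \<comment> \<open>The product rule leaves the undifferentiated factors at the base point for
      \<open>t = 0\<close>, which has to be recognised as \<open>y\<close>.\<close>
    have "y + 0 \<cdot>\<^sub>v p = y" using that torus_carrier[OF y] by auto
    thus "((\<lambda>t. dlog (coord (2*k-1)) (y + t \<cdot>\<^sub>v p) q * dlog (coord (2*j)) (y + t \<cdot>\<^sub>v p) r
        - dlog (coord (2*k-1)) (y + t \<cdot>\<^sub>v p) r * dlog (coord (2*j)) (y + t \<cdot>\<^sub>v p) q)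
      has_field_derivative D (2*k-1) (2*j) p q r) (at 0)"
      by (intro DERIV_cong[OF deriv]) (simp add: D_def wedge_def algebra_simps)
  qed
  have "D a b u v w - D a b v u w + D a b w u v = 0" for a b
    by (simp add: D_def wedge_def algebra_simps)
  hence "4 * (\<Sum>k=1..K. \<Sum>j=k..K.
      D (2*k-1) (2*j) u v w - D (2*k-1) (2*j) v u w + D (2*k-1) (2*j) w u v) = 0"
    by simp
  thus "dif (\<lambda>z. W K z v w) y u - dif (\<lambda>z. W K z u w) y v + dif (\<lambda>z. W K z u v) y w = 0"
    using uvw by (simp add: dif sum.distrib sum_subtractf algebra_simps)
qed

section \<open>The logarithmic frame and coefficient matrices\<close>

text \<open>The components of the tangent vector \<open>v\<close> at \<open>y\<close> in the frame
  \<open>y_i \<partial>/\<partial>y_i\<close>. Going back from components to tangent vectors is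
  \<open>exp_vec\<close>; both maps are linear in the second argument.\<close>

definition log_vec :: "complex vec \<Rightarrow> complex vec \<Rightarrow> complex vec" where
  "log_vec y v = vec (dim_vec y) (\<lambda>i. v $ i / y $ i)"

definition exp_vec :: "complex vec \<Rightarrow> complex vec \<Rightarrow> complex vec" where
  "exp_vec y x = vec (dim_vec y) (\<lambda>i. y $ i * x $ i)"

lemma log_vec_carrier: "y \<in> carrier_vec n \<Longrightarrow> log_vec y v \<in> carrier_vec n"
  by (auto simp: log_vec_def)

lemma exp_vec_carrier: "y \<in> carrier_vec n \<Longrightarrow> exp_vec y x \<in> carrier_vec n"
  by (auto simp: exp_vec_def)

lemma log_vec_exp_vec:
  "y \<in> torus n \<Longrightarrow> x \<in> carrier_vec n \<Longrightarrow> log_vec y (exp_vec y x) = x"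
  by (auto simp: log_vec_def exp_vec_def torus_def)

lemma exp_vec_log_vec:
  "y \<in> torus n \<Longrightarrow> v \<in> carrier_vec n \<Longrightarrow> exp_vec y (log_vec y v) = v"
  by (auto simp: log_vec_def exp_vec_def torus_def)

lemma log_coeff_sum_eq:
  assumes M: "M \<in> carrier_mat n n" "transpose_mat M = - M"
    and y: "y \<in> torus n" and uv: "u \<in> carrier_vec n" "v \<in> carrier_vec n"
  shows "(\<Sum>j=1..n. \<Sum>i=1..<j.
            M $$ (i-1, j-1) * wedge (dlog (coord i)) (dlog (coord j)) y u v)
       = log_vec y u \<bullet> (M *\<^sub>v log_vec y v)"
proof -
  let ?a = "\<lambda>i. u $ i / y $ i" and ?b = "\<lambda>i. v $ i / y $ i"
  define G where "G i j = M $$ (i, j) * ?a i * ?b j" for i j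
  note yc = torus_carrier[OF y]
  have skew: "M $$ (j, i) = - M $$ (i, j)" if "i < n" "j < n" for i j
    using M that by (metis carrier_matD index_transpose_mat(1) index_uminus_mat(1))
  have diag: "M $$ (i, i) = 0" if "i < n" for i
    using skew[OF that that] by simp
  have "(\<Sum>j=1..n. \<Sum>i=1..<j.
            M $$ (i-1, j-1) * wedge (dlog (coord i)) (dlog (coord j)) y u v)
      = (\<Sum>j<n. \<Sum>i<j. M $$ (i, j) *
           wedge (dlog (coord (Suc i))) (dlog (coord (Suc j))) y u v)"
    by (simp add: sum.atLeast1_atMost_eq atLeastLessThanSuc_atLeastAtMost)
  also have "\<dots> = (\<Sum>j<n. \<Sum>i<j. G i j + G j i)"
  proof (intro sum.cong refl)
    fix i j assume "j \<in> {..<n}" "i \<in> {..<j}"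
    thus "M $$ (i, j) * wedge (dlog (coord (Suc i))) (dlog (coord (Suc j))) y u v
        = G i j + G j i"
      using skew[of i j] uv yc
      by (simp add: wedge_def dlog_coord[of _ n] G_def algebra_simps)
  qed
  \<comment> \<open>The guards make the diagonal vanish for every index, as
    \<open>sum_all_pairs_eq\<close> demands; skewness of \<open>M\<close> gives this only below
    \<open>n\<close>.\<close>
  also have "\<dots> = (\<Sum>j<n. \<Sum>i<j. (if i < n \<and> j < n then G i j else 0)
                               + (if j < n \<and> i < n then G j i else 0))"
    by (intro sum.cong) auto
  also have "\<dots> = (\<Sum>i<n. \<Sum>j<n. if i < n \<and> j < n then G i j else 0)"
    by (rule sum_all_pairs_eq[symmetric]) (simp add: G_def diag)
  also have "\<dots> = (\<Sum>i<n. ?a i * (\<Sum>j<n. M $$ (i, j) * ?b j))"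
    by (simp add: G_def sum_distrib_left mult_ac)
  also have "\<dots> = log_vec y u \<bullet> (M *\<^sub>v log_vec y v)"
    using M yc by (simp add: log_vec_def scalar_prod_def atLeast0LessThan)
  finally show ?thesis .
qed

lemma log_coeff_form:
  assumes "is_log_coeff_mat n \<omega> M" "y \<in> torus n" "u \<in> carrier_vec n" "v \<in> carrier_vec n"
  shows "\<omega> y u v = log_vec y u \<bullet> (M *\<^sub>v log_vec y v)"
  using assms log_coeff_sum_eq[of M n y u v] unfolding is_log_coeff_mat_def by auto

lemma log_coeff_entry:
  assumes M: "is_log_coeff_mat n \<omega> M" and y: "y \<in> torus n" and ij: "i < n" "j < n"
  shows "\<omega> y (exp_vec y (unit_vec n i)) (exp_vec y (unit_vec n j)) = M $$ (i, j)"
proof -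
  have "M \<in> carrier_mat n n" using M by (simp add: is_log_coeff_mat_def)
  thus ?thesis
    using ij log_coeff_form[OF M y] y
    by (simp add: log_vec_exp_vec exp_vec_carrier torus_carrier)
qed

lemma log_coeff_unique:
  assumes M: "is_log_coeff_mat n \<omega> M" and N: "is_log_coeff_mat n \<omega> N"
  shows "M = N"
proof -
  \<comment> \<open>The coefficients are constant, so a single point of the torus determines
    them.\<close>
  have "vec n (\<lambda>_. 1) \<in> torus n" by (simp add: torus_def)
  from log_coeff_entry[OF M this] log_coeff_entry[OF N this]
  show ?thesis
    using M N by (intro eq_matI) (auto simp: is_log_coeff_mat_def)
qed

section \<open>Two-forms with invertible coefficient matrix\<close>

locale log_coeff_inverse =
  fixes n :: nat and \<omega> :: two_form and M N :: "complex mat"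
  assumes M: "is_log_coeff_mat n \<omega> M"
    and N: "N \<in> carrier_mat n n"
    and MN: "M * N = 1\<^sub>m n" and NM: "N * M = 1\<^sub>m n"
begin

lemma M_carrier: "M \<in> carrier_mat n n"
  using M by (simp add: is_log_coeff_mat_def)

text \<open>Since \<open>M\<close> sends column \<open>b\<close> of \<open>N\<close> to the unit
  vector \<open>b\<close>, pairing \<open>u\<close> with the tangent vector of that column reads off
  component \<open>b\<close>.\<close>

lemma log_vec_recover:
  assumes y: "y \<in> torus n" and u: "u \<in> carrier_vec n" and b: "b < n"
  shows "log_vec y u $ b = \<omega> y u (exp_vec y (col N b))"
proof -
  have "M *\<^sub>v col N b = unit_vec n b"
    using M_carrier N MN b by (metis col_mult2 col_one)
  thus ?thesis
    using log_coeff_form[OF M y u] y N b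
    by (simp add: log_vec_exp_vec exp_vec_carrier torus_carrier log_vec_carrier)
qed

text \<open>All components of \<open>u\<close> are values of the form by
  \<open>log_vec_recover\<close>. This yields both nondegeneracy and the uniqueness of Hamiltonian
  vectors.\<close>

lemma form_left_cancel:
  assumes "y \<in> torus n" "u \<in> carrier_vec n" "u' \<in> carrier_vec n"
    and "\<And>v. v \<in> carrier_vec n \<Longrightarrow> \<omega> y u v = \<omega> y u' v"
  shows "u = u'"
proof -
  have "log_vec y u = log_vec y u'"
    using assms log_vec_recover[OF assms(1)]
    by (intro eq_vecI) (simp_all add: exp_vec_carrier torus_carrier log_vec_def
        torus_carrier[THEN carrier_vecD])
  thus ?thesis
    using assms exp_vec_log_vec by metis
qed

lemma nondegenerate: "nondegenerate_form n \<omega>"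
  unfolding nondegenerate_form_def
proof (intro ballI impI)
  fix y u assume y: "y \<in> torus n" and u: "u \<in> carrier_vec n" "\<forall>v\<in>carrier_vec n. \<omega> y u v = 0"
  have "log_vec y (0\<^sub>v n) = 0\<^sub>v n"
    using torus_carrier[OF y] by (auto simp: log_vec_def)
  hence "\<omega> y (0\<^sub>v n) v = 0" if "v \<in> carrier_vec n" for v
    using log_coeff_form[OF M y _ that, of "0\<^sub>v n"] M_carrier
      log_vec_carrier[OF torus_carrier[OF y], of v] by simp
  thus "u = 0\<^sub>v n" using u form_left_cancel[OF y] by simp
qed

text \<open>Row \<open>i-1\<close> of \<open>N\<close> times \<open>M\<close> is a unit row, so the
  tangent vector of that row pairs with \<open>v\<close> to \<open>d log y_i (v)\<close>; the factor
  \<open>y_i\<close> turns this into \<open>dy_i (v)\<close>.\<close>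

lemma hamiltonian_vector_coord:
  assumes y: "y \<in> torus n" and i: "i \<in> {1..n}"
  shows "hamiltonian_vector n \<omega> (coord i) y = y $ (i - 1) \<cdot>\<^sub>v exp_vec y (row N (i - 1))"
    (is "_ = ?X")
    and "\<And>v. v \<in> carrier_vec n \<Longrightarrow>
      \<omega> y (hamiltonian_vector n \<omega> (coord i) y) v = dif (coord i) y v"
proof -
  note yc = torus_carrier[OF y]
  have X: "?X \<in> carrier_vec n" using yc by (simp add: exp_vec_carrier)
  have row: "row N (i - 1) \<in> carrier_vec n" using N by auto
  have log: "log_vec y ?X = y $ (i - 1) \<cdot>\<^sub>v row N (i - 1)"
    using y N by (auto simp: log_vec_def exp_vec_def torus_def)
  have form: "\<omega> y ?X v = dif (coord i) y v" if v: "v \<in> carrier_vec n" for v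
  proof -
    note l = log_vec_carrier[OF yc, of v]
    have "\<omega> y ?X v = y $ (i - 1) * (row N (i - 1) \<bullet> (M *\<^sub>v log_vec y v))"
      using log_coeff_form[OF M y X v] log row M_carrier l by simp
    also have "row N (i - 1) \<bullet> (M *\<^sub>v log_vec y v) = (N *\<^sub>v (M *\<^sub>v log_vec y v)) $ (i - 1)"
      using N i by auto
    also have "N *\<^sub>v (M *\<^sub>v log_vec y v) = log_vec y v"
      using assoc_mult_mat_vec[OF N M_carrier l] NM l by simp
    also have "y $ (i - 1) * log_vec y v $ (i - 1) = v $ (i - 1)"
      using y i by (auto simp: log_vec_def torus_def)
    finally show ?thesis using dif_coord[OF v yc i] by simp
  qed
  show *: "hamiltonian_vector n \<omega> (coord i) y = ?X"
    unfolding hamiltonian_vector_def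
    using X form form_left_cancel[OF y _ X] by (intro the_equality) auto
  show "\<omega> y (hamiltonian_vector n \<omega> (coord i) y) v = dif (coord i) y v"
    if "v \<in> carrier_vec n" for v
    using form[OF that] * by simp
qed

text \<open>The bracket is \<open>dy_i\<close> applied to the Hamiltonian vector of
  \<open>y_j\<close>, which is built from row \<open>j-1\<close> of \<open>N\<close>. Hence the
  entry at \<open>(j-1, i-1)\<close> appears, and with it the transpose.\<close>

lemma poisson_bracket_coord:
  assumes y: "y \<in> torus n" and ij: "i \<in> {1..n}" "j \<in> {1..n}"
  shows "poisson_bracket n \<omega> (coord i) (coord j) y
       = transpose_mat N $$ (i-1, j-1) * coord i y * coord j y"
proof -
  note yc = torus_carrier[OF y]
  let ?X = "y $ (j - 1) \<cdot>\<^sub>v exp_vec y (row N (j - 1))"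
  have X: "?X \<in> carrier_vec n" using yc by (simp add: exp_vec_carrier)
  have "poisson_bracket n \<omega> (coord i) (coord j) y = dif (coord i) y ?X"
    unfolding poisson_bracket_def
    using hamiltonian_vector_coord(2)[OF y ij(1) X] hamiltonian_vector_coord(1)[OF y ij(2)] by simp
  also have "\<dots> = ?X $ (i - 1)" by (rule dif_coord[OF X yc ij(1)])
  also have "\<dots> = transpose_mat N $$ (i-1, j-1) * coord i y * coord j y"
    using yc ij N by (auto simp: exp_vec_def coord_def)
  finally show ?thesis .
qed

lemma the_log_coeff_mat: "(THE M. is_log_coeff_mat n \<omega> M) = M"
  using M log_coeff_unique[OF _ M] by (rule the_equality)

text \<open>The result \<open>None\<close> would say that \<open>M\<close> is not a unit of the
  matrix ring, contrary to \<open>N\<close>; any other result equals \<open>N\<close> by uniqueness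
  of inverses.\<close>

lemma the_mat_inverse: "the (mat_inverse M) = N"
proof (cases "mat_inverse M")
  case None
  from mat_inverse(1)[OF M_carrier None] show ?thesis
    using M_carrier N MN NM by (auto simp: Units_def ring_mat_def)
next
  case (Some B)
  from mat_inverse(2)[OF M_carrier Some] show ?thesis
    using M_carrier N MN Some
    by (metis assoc_mult_mat left_mult_one_mat option.sel right_mult_one_mat)
qed

lemma invertible: "invertible_mat M"
  using M_carrier N MN NM by (auto simp: invertible_mat_def inverts_mat_def)

end

section \<open>The coefficient matrix of \<open>W K\<close> and its inverse\<close>

text \<open>Since matrix indices start at \<open>0\<close>, the parities are opposite to those of the coordinates
  \<open>y\<^sub>i\<close>: the entry \<open>(a, b)\<close> belongs to \<open>d log y\<^bsub>a+1\<^esub> \<and> d log y\<^bsub>b+1\<^esub>\<close>.\<close>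

definition omega_mat :: "nat \<Rightarrow> complex mat" where
  "omega_mat K = mat (2*K) (2*K) (\<lambda>(a, b).
     if a < b \<and> even a \<and> odd b then 4 else if b < a \<and> odd a \<and> even b then -4 else 0)"

text \<open>This is the inverse before transposition, so the positive entries lie below the
  diagonal, opposite to \<open>P K\<close>.\<close>

definition omega_inv :: "nat \<Rightarrow> complex mat" where
  "omega_inv K = mat (2*K) (2*K) (\<lambda>(a, b).
     if a = b + 1 then 1/4 else if b = a + 1 then -(1/4) else 0)"

lemma is_log_coeff_mat_omega: "is_log_coeff_mat (2*K) (W K) (omega_mat K)"
  unfolding is_log_coeff_mat_def
proof (intro conjI ballI)
  show "omega_mat K \<in> carrier_mat (2*K) (2*K)" by (simp add: omega_mat_def)
  show "transpose_mat (omega_mat K) = - omega_mat K"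
    by (intro eq_matI) (auto simp: omega_mat_def)
  fix y u v
  let ?w = "\<lambda>i j. wedge (dlog (coord i)) (dlog (coord j)) y u v"
  have "W K y u v = (\<Sum>j=1..2*K. \<Sum>i=1..<j. 4 * (if odd i \<and> even j then ?w i j else 0))"
    unfolding W_def sum_odd_even_pairs[of ?w K] by (simp only: sum_distrib_left)
  also have "\<dots> = (\<Sum>j=1..2*K. \<Sum>i=1..<j. omega_mat K $$ (i-1, j-1) * ?w i j)"
    \<comment> \<open>For \<open>1 \<le> i < j\<close> the shift by one flips both parities and
      keeps the order, so only the values \<open>4\<close> and \<open>0\<close> occur.\<close>
    by (intro sum.cong) (auto simp: omega_mat_def diff_less_mono)
  finally show "W K y u v = (\<Sum>j=1..2*K. \<Sum>i=1..<j. omega_mat K $$ (i-1, j-1) * ?w i j)" .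
qed

text \<open>Column \<open>c\<close> of \<open>omega_inv\<close> has at most two nonzero entries,
  next to the diagonal, so the product at \<open>(a, c)\<close> is a difference
  \<open>s (c+1) - s (c-1)\<close>. On indices of parity opposite to \<open>a\<close>,
  \<open>s\<close> is a step function jumping by 1 across \<open>a\<close>; on the others it is
  zero. Hence the difference is 1 exactly for \<open>a = c\<close>.\<close>

lemma omega_mat_inverse: "omega_mat K * omega_inv K = 1\<^sub>m (2*K)"
proof (rule eq_matI)
  fix a c assume "a < dim_row (1\<^sub>m (2*K))" "c < dim_col (1\<^sub>m (2*K))"
  hence a: "a < 2*K" and c: "c < 2*K" by auto
  \<comment> \<open>Row \<open>a\<close> of \<open>omega_mat\<close> divided by 4; the factor 4
    cancels the \<open>1/4\<close> in \<open>omega_inv\<close>.\<close>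
  define s :: "nat \<Rightarrow> complex" where "s b =
     (if a < b \<and> even a \<and> odd b then 1 else if b < a \<and> odd a \<and> even b then -1 else 0)" for b
  have "(omega_mat K * omega_inv K) $$ (a, c)
      = (\<Sum>b<2*K. (if b = c + 1 then s b else 0) - (if c = b + 1 then s b else 0))"
    using a c by (auto simp: omega_mat_def omega_inv_def scalar_prod_def atLeast0LessThan s_def
        intro!: sum.cong)
  also have "\<dots> = (if c + 1 < 2*K then s (c + 1) else 0) - (if c = 0 then 0 else s (c - 1))"
  proof -
    have "(\<Sum>b<2*K. if c = b + 1 then s b else 0) = (if c = 0 then 0 else s (c - 1))"
      using c by (cases c) simp_all
    thus ?thesis by (simp add: sum_subtractf)
  qed
  also have "\<dots> = (if a = c then 1 else 0)"
  proof -
    \<comment> \<open>The size is even, so the last index is odd and every even column has a right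
      neighbour. In the last column the term \<open>s (c+1)\<close> is absent, which agrees with
      \<open>s (2*K) = 0\<close>.\<close>
    have "c + 1 < 2*K" if "even c"
      using c that by presburger
    moreover have "\<not> c + 1 < 2*K \<Longrightarrow> a \<le> c" using a c by simp
    ultimately show ?thesis using a c
      by (cases c) (auto simp: s_def less_Suc_eq, presburger+)
  qed
  finally show "(omega_mat K * omega_inv K) $$ (a, c) = 1\<^sub>m (2*K) $$ (a, c)"
    using a c by simp
qed (simp_all add: omega_mat_def omega_inv_def)

theorem lemma3p7:
  fixes K :: nat
  assumes "K \<ge> 1"
  shows "closed_form (2*K) (W K) \<and> nondegenerate_form (2*K) (W K) \<and>
         (\<exists>!M. is_log_coeff_mat (2*K) (W K) M) \<and>
         invertible_mat (Omega K) \<and>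
         (\<forall>y\<in>torus (2*K). \<forall>i\<in>{1..2*K}. \<forall>j\<in>{1..2*K}.
            poisson_bracket (2*K) (W K) (coord i) (coord j) y
              = P K $$ (i-1, j-1) * coord i y * coord j y) \<and>
         P K \<in> carrier_mat (2*K) (2*K) \<and>
         (\<forall>i\<in>{1..2*K}. \<forall>j\<in>{1..2*K}.
            P K $$ (i-1, j-1) =
              (if j = i + 1 then 1/4 else if i = j + 1 then - (1/4) else 0))"
proof -
  have inv: "omega_inv K \<in> carrier_mat (2*K) (2*K)" by (simp add: omega_inv_def)
  have "omega_mat K \<in> carrier_mat (2*K) (2*K)" by (simp add: omega_mat_def)
  \<comment> \<open>For square matrices the one-sided inverse is two-sided, which supplies the
    second product identity of the locale.\<close>
  then interpret log_coeff_inverse "2*K" "W K" "omega_mat K" "omega_inv K"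
    using is_log_coeff_mat_omega inv omega_mat_inverse mat_mult_left_right_inverse
    by unfold_locales blast+
  have Omega: "Omega K = omega_mat K"
    unfolding Omega_def by (rule the_log_coeff_mat)
  have P: "P K = transpose_mat (omega_inv K)"
    unfolding P_def Omega the_mat_inverse ..
  have "\<exists>!M. is_log_coeff_mat (2*K) (W K) M"
    using M log_coeff_unique by blast
  moreover have "\<forall>i\<in>{1..2*K}. \<forall>j\<in>{1..2*K}. P K $$ (i-1, j-1) =
      (if j = i + 1 then 1/4 else if i = j + 1 then - (1/4) else 0)"
    by (auto simp: P omega_inv_def)
  ultimately show ?thesis
    using closed_form_W nondegenerate invertible inv poisson_bracket_coord
    unfolding Omega P by simp
qed

end
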